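(* For every integer $n\ge0$ and every reduced quaternion $x=x_0+ix_1+jx_2$ with $\rho=\sqrt{x_1^2+x_2^2}>0$, $$\frac{\pi}{2}(-1)^nJ_{2n}(x)=\int_0^1\frac{\cos(2n\arccos\tau)}{\sqrt{1-\tau^2}}\cos(x\tau)\,d\tau$$ and $$\frac{\pi}{2}(-1)^nJ_{2n+1}(x)=\int_0^1\frac{\cos[(2n+1)\arccos\tau]}{\sqrt{1-\tau^2}}\sin(x\tau)\,d\tau.$$
   Context: Let $i,j$ be quaternionic imaginary units. For $x=x_0+ix_1+jx_2$ with $\rho=\sqrt{x_1^2+x_2^2}>0$ put $I=\frac{ix_1+jx_2}{\rho}$, so $I^2=-1$ and $x=x_0+I\rho$. Define $e^{a+Ib}=e^{a}(\cos b+I\sin b)$ for $a,b\in\mathbb{R}$, $\cos x=\frac12\left(e^{-Ix}+e^{Ix}\right)$, $\sin x=\frac{I}{2}\left(e^{-Ix}-e^{Ix}\right)$, where $Ix=-\rho+Ix_0$; for real $\tau>0$ these are applied to $x\tau$. The Bessel function of the first kind of integer order $m\ge0$ and reduced quaternionic argument is defined by the power series $$J_m(x)=\sum_{k=0}^\infty\frac{(-1)^k}{k!\,(m+k)!}\left(\frac{x}{2}\right)^{m+2k},$$ with quaternionic powers of $x$. *)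

theory Defs
  imports "HOL-Analysis.Analysis"
begin

section \<open>The real algebra of quaternions\<close>

datatype quat = Quat (qRe: real) (qI: real) (qJ: real) (qK: real)

lemma quat_eq_iff: "x = y \<longleftrightarrow> qRe x = qRe y \<and> qI x = qI y \<and> qJ x = qJ y \<and> qK x = qK y"
  by (cases x; cases y) simp

lemma quat_eqI: "qRe x = qRe y \<Longrightarrow> qI x = qI y \<Longrightarrow> qJ x = qJ y \<Longrightarrow> qK x = qK y \<Longrightarrow> x = y"
  by (simp add: quat_eq_iff)

instantiation quat :: real_algebra_1
begin

definition "0 = Quat 0 0 0 0"
definition "1 = Quat 1 0 0 0"
definition "x + y = Quat (qRe x + qRe y) (qI x + qI y) (qJ x + qJ y) (qK x + qK y)"
definition "- x = Quat (- qRe x) (- qI x) (- qJ x) (- qK x)"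
definition "x - y = Quat (qRe x - qRe y) (qI x - qI y) (qJ x - qJ y) (qK x - qK y)"
definition "x * y = Quat
  (qRe x * qRe y - qI x * qI y - qJ x * qJ y - qK x * qK y)
  (qRe x * qI y + qI x * qRe y + qJ x * qK y - qK x * qJ y)
  (qRe x * qJ y - qI x * qK y + qJ x * qRe y + qK x * qI y)
  (qRe x * qK y + qI x * qJ y - qJ x * qI y + qK x * qRe y)"
definition "r *\<^sub>R x = Quat (r * qRe x) (r * qI x) (r * qJ x) (r * qK x)"

lemmas quat_ops = zero_quat_def one_quat_def plus_quat_def uminus_quat_def minus_quat_def
  times_quat_def scaleR_quat_def

instance
  by standard (simp_all add: quat_ops quat_eq_iff algebra_simps)

end

lemma quat_sel_simps [simp]:
  "qRe 0 = 0" "qI 0 = 0" "qJ 0 = 0" "qK 0 = 0"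
  "qRe 1 = 1" "qI 1 = 0" "qJ 1 = 0" "qK 1 = 0"
  "qRe (x + y) = qRe x + qRe y" "qI (x + y) = qI x + qI y"
  "qJ (x + y) = qJ x + qJ y" "qK (x + y) = qK x + qK y"
  "qRe (- x) = - qRe x" "qI (- x) = - qI x" "qJ (- x) = - qJ x" "qK (- x) = - qK x"
  "qRe (x - y) = qRe x - qRe y" "qI (x - y) = qI x - qI y"
  "qJ (x - y) = qJ x - qJ y" "qK (x - y) = qK x - qK y"
  "qRe (r *\<^sub>R x) = r * qRe x" "qI (r *\<^sub>R x) = r * qI x"
  "qJ (r *\<^sub>R x) = r * qJ x" "qK (r *\<^sub>R x) = r * qK x"
  by (simp_all add: quat_ops)

lemma quat_mult_sel:
  "qRe (x * y) = qRe x * qRe y - qI x * qI y - qJ x * qJ y - qK x * qK y"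
  "qI (x * y) = qRe x * qI y + qI x * qRe y + qJ x * qK y - qK x * qJ y"
  "qJ (x * y) = qRe x * qJ y - qI x * qK y + qJ x * qRe y + qK x * qI y"
  "qK (x * y) = qRe x * qK y + qI x * qJ y - qJ x * qI y + qK x * qRe y"
  by (simp_all add: times_quat_def)

instantiation quat :: real_inner
begin

definition "inner x y = qRe x * qRe y + qI x * qI y + qJ x * qJ y + qK x * qK y"
definition "norm (x::quat) = sqrt (inner x x)"
definition "sgn (x::quat) = x /\<^sub>R norm x"
definition "dist (x::quat) y = norm (x - y)"
definition "(uniformity :: (quat \<times> quat) filter) = (INF e\<in>{0<..}. principal {(x, y). dist x y < e})"
definition "open (U :: quat set) \<longleftrightarrow> (\<forall>x\<in>U. eventually (\<lambda>(x', y). x' = x \<longrightarrow> y \<in> U) uniformity)"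

instance
proof
  fix x y z :: quat and r :: real
  show "inner x y = inner y x" "inner (x + y) z = inner x z + inner y z"
    "inner (r *\<^sub>R x) y = r * inner x y"
    by (simp_all add: inner_quat_def algebra_simps)
  show "0 \<le> inner x x" by (simp add: inner_quat_def)
  have sq: "a * a + b * b + c * c + d * d = 0 \<longleftrightarrow> a = 0 \<and> b = 0 \<and> c = 0 \<and> d = 0" for a b c d :: real
  proof
    assume "a * a + b * b + c * c + d * d = 0"
    moreover have "0 \<le> a * a" "0 \<le> b * b" "0 \<le> c * c" "0 \<le> d * d" by simp_all
    ultimately have "a * a = 0" "b * b = 0" "c * c = 0" "d * d = 0" by linarith+
    then show "a = 0 \<and> b = 0 \<and> c = 0 \<and> d = 0" by simp
  qed simp
  show "inner x x = 0 \<longleftrightarrow> x = 0"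
    by (simp add: inner_quat_def quat_eq_iff sq)
qed (simp_all add: norm_quat_def sgn_quat_def dist_quat_def uniformity_quat_def open_quat_def)

end

instantiation quat :: real_normed_div_algebra
begin

definition "inverse x =
  Quat (qRe x) (- qI x) (- qJ x) (- qK x) /\<^sub>R inner x x"
definition "x div (y::quat) = x * inverse y"

instance
proof
  fix x y :: quat
  have *: "Quat (qRe x) (- qI x) (- qJ x) (- qK x) * x = inner x x *\<^sub>R 1"
    "x * Quat (qRe x) (- qI x) (- qJ x) (- qK x) = inner x x *\<^sub>R 1"
    by (simp_all add: quat_eq_iff quat_mult_sel inner_quat_def)
  show "x \<noteq> 0 \<Longrightarrow> inverse x * x = 1" "x \<noteq> 0 \<Longrightarrow> x * inverse x = 1"
    by (simp_all add: inverse_quat_def *)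
  show "x div y = x * inverse y" by (rule divide_quat_def)
  show "inverse (0::quat) = 0" by (simp add: inverse_quat_def)
  have "inner (x * y) (x * y) = inner x x * inner y y"
    by (simp add: inner_quat_def quat_mult_sel algebra_simps)
  then show "norm (x * y) = norm x * norm y"
    by (simp add: norm_quat_def real_sqrt_mult)
qed

end

instantiation quat :: euclidean_space
begin

definition "Basis = {Quat 1 0 0 0, Quat 0 1 0 0, Quat 0 0 1 0, Quat 0 0 0 1}"

instance
proof
  fix x :: quat
  show "(\<forall>u\<in>Basis. inner x u = 0) \<longleftrightarrow> x = 0"
    unfolding Basis_quat_def ball_simps by (auto simp: inner_quat_def quat_eq_iff)
qed (auto simp: Basis_quat_def inner_quat_def)

end


section \<open>Reduced quaternions\<close>

definition quat_i :: quat where "quat_i = Quat 0 1 0 0"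
definition quat_j :: quat where "quat_j = Quat 0 0 1 0"
definition quat_k :: quat where "quat_k = Quat 0 0 0 1"

lemma quat_units:
  "quat_i * quat_i = -1" "quat_j * quat_j = -1" "quat_k * quat_k = -1"
  "quat_i * quat_j = quat_k" "quat_j * quat_i = - quat_k"
  by (simp_all add: quat_i_def quat_j_def quat_k_def quat_eq_iff quat_mult_sel)

definition rq :: "real \<Rightarrow> real \<Rightarrow> real \<Rightarrow> quat" where
  "rq x0 x1 x2 = of_real x0 + quat_i * of_real x1 + quat_j * of_real x2"

definition rq_rho :: "quat \<Rightarrow> real" where
  "rq_rho x = sqrt ((qI x)\<^sup>2 + (qJ x)\<^sup>2)"

definition rq_unit :: "quat \<Rightarrow> quat" where
  "rq_unit x = (quat_i * of_real (qI x) + quat_j * of_real (qJ x)) / of_real (rq_rho x)"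

lemma of_real_quat_sel [simp]:
  "qRe (of_real r) = r" "qI (of_real r) = 0" "qJ (of_real r) = 0" "qK (of_real r) = 0"
  by (simp_all add: of_real_def)

lemma rq_sel: "qRe (rq a b c) = a" "qI (rq a b c) = b" "qJ (rq a b c) = c" "qK (rq a b c) = 0"
  by (simp_all add: rq_def quat_i_def quat_j_def quat_mult_sel)

lemma rq_unit_eq: "rq_unit x = Quat 0 (qI x / rq_rho x) (qJ x / rq_rho x) 0"
  by (simp add: rq_unit_def divide_quat_def quat_eq_iff quat_mult_sel quat_i_def quat_j_def
      divide_inverse flip: of_real_inverse)

lemma
  assumes "rq_rho x > 0"
  shows rq_unit_square: "rq_unit x * rq_unit x = -1"
    and rq_unit_inner: "inner (rq_unit x) (rq_unit x) = 1"
proof -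
  have "(rq_rho x)\<^sup>2 = (qI x)\<^sup>2 + (qJ x)\<^sup>2" by (simp add: rq_rho_def)
  moreover have "qI x \<noteq> 0 \<or> qJ x \<noteq> 0" using assms by (auto simp: rq_rho_def)
  ultimately have "(qI x / rq_rho x)\<^sup>2 + (qJ x / rq_rho x)\<^sup>2 = 1"
    by (auto simp: power_divide simp flip: add_divide_distrib)
  then have *: "qI x / rq_rho x * (qI x / rq_rho x) + qJ x / rq_rho x * (qJ x / rq_rho x) = 1"
    by (simp only: power2_eq_square)
  show "inner (rq_unit x) (rq_unit x) = 1"
    using * by (simp add: rq_unit_eq inner_quat_def)
  show "rq_unit x * rq_unit x = -1"
    using * by (simp add: rq_unit_eq quat_eq_iff quat_mult_sel)
qed

lemma rq_decomp:
  assumes "qK x = 0" "rq_rho x > 0"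
  shows "x = of_real (qRe x) + rq_unit x * of_real (rq_rho x)"
  using assms by (simp add: rq_unit_eq quat_eq_iff quat_mult_sel)

lemma rq_unit_mult:
  assumes "qK x = 0" "rq_rho x > 0"
  shows "rq_unit x * x = of_real (- rq_rho x) + rq_unit x * of_real (qRe x)"
proof -
  have "rq_unit x * x = rq_unit x * (of_real (qRe x) + rq_unit x * of_real (rq_rho x))"
    using rq_decomp[OF assms] by simp
  also have "\<dots> = rq_unit x * of_real (qRe x) + (rq_unit x * rq_unit x) * of_real (rq_rho x)"
    by (simp add: distrib_left mult.assoc)
  finally show ?thesis
    by (simp add: rq_unit_square[OF assms(2)])
qed

lemma rq_rho_scale: "\<tau> > 0 \<Longrightarrow> rq_rho (\<tau> *\<^sub>R x) = \<tau> * rq_rho x"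
proof -
  assume "\<tau> > 0"
  have "rq_rho (\<tau> *\<^sub>R x) = sqrt (\<tau>\<^sup>2 * ((qI x)\<^sup>2 + (qJ x)\<^sup>2))"
    by (simp add: rq_rho_def algebra_simps)
  with \<open>\<tau> > 0\<close> show ?thesis by (simp add: real_sqrt_mult rq_rho_def)
qed

lemma rq_unit_scale: "\<tau> > 0 \<Longrightarrow> rq_unit (\<tau> *\<^sub>R x) = rq_unit x"
  by (simp add: rq_unit_eq rq_rho_scale)


section \<open>Exponential, cosine and sine\<close>

text \<open>
  For an imaginary unit \<open>u\<close>, \<open>slice_exp u q\<close> is \<open>e\<^sup>q\<close> for \<open>q = a + u b\<close> with real \<open>a\<close> and \<open>b\<close>;
  the coordinate \<open>b\<close> is recovered as the inner product of \<open>q\<close> and \<open>u\<close>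
  (see \<open>slice_exp_eq\<close>). It is a junk value for \<open>q\<close> outside this plane.
\<close>

definition slice_exp :: "quat \<Rightarrow> quat \<Rightarrow> quat" where
  "slice_exp u q = of_real (exp (qRe q)) *
     (of_real (cos (inner q u)) + u * of_real (sin (inner q u)))"

lemma slice_exp_eq:
  assumes "qRe u = 0" "inner u u = 1"
  shows "slice_exp u (of_real a + u * of_real b) =
    of_real (exp a) * (of_real (cos b) + u * of_real (sin b))"
proof -
  have "inner (of_real a + u * of_real b) u = b"
  proof -
    have "inner (of_real a + u * of_real b) u = b * inner u u"
      using assms(1) by (simp add: inner_quat_def quat_mult_sel algebra_simps)
    then show ?thesis using assms(2) by simp
  qed
  then show ?thesis using assms(1) by (simp add: slice_exp_def quat_mult_sel)
qed

definition rq_cos :: "quat \<Rightarrow> quat" where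
  "rq_cos x = 1 / 2 * (slice_exp (rq_unit x) (- (rq_unit x * x)) + slice_exp (rq_unit x) (rq_unit x * x))"

definition rq_sin :: "quat \<Rightarrow> quat" where
  "rq_sin x = rq_unit x / 2 * (slice_exp (rq_unit x) (- (rq_unit x * x)) - slice_exp (rq_unit x) (rq_unit x * x))"


section \<open>Bessel functions of the first kind\<close>

definition rq_bessel :: "nat \<Rightarrow> quat \<Rightarrow> quat" where
  "rq_bessel m x = (\<Sum>k. of_real ((-1) ^ k / (fact k * fact (m + k))) * (x / 2) ^ (m + 2 * k))"

lemma summable_rq_bessel:
  "summable (\<lambda>k. of_real ((-1) ^ k / (fact k * fact (m + k))) * (x / 2 :: quat) ^ (m + 2 * k))"
proof (rule summable_comparison_test)
  let ?r = "norm (x / 2)"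
  have "norm (of_real ((-1) ^ k / (fact k * fact (m + k))) * (x / 2) ^ (m + 2 * k))
      \<le> ?r ^ m * (inverse (fact k) * (?r\<^sup>2) ^ k)" for k
  proof -
    have "1 / (fact k * fact (m + k)) \<le> (1 / fact k :: real)"
      by (rule divide_left_mono) (auto simp: mult_le_cancel_left1 fact_ge_1)
    then have "1 / (fact k * fact (m + k)) * ?r ^ (m + 2 * k) \<le> 1 / fact k * ?r ^ (m + 2 * k)"
      by (rule mult_right_mono) simp
    moreover have "(?r\<^sup>2) ^ k = ?r ^ (2 * k)" by (simp only: power_mult)
    ultimately show ?thesis
      unfolding norm_mult norm_of_real norm_power
      by (simp add: abs_mult power_add inverse_eq_divide mult.commute mult.left_commute)
  qed
  then show "\<exists>N. \<forall>k\<ge>N. norm (of_real ((-1) ^ k / (fact k * fact (m + k))) * (x / 2) ^ (m + 2 * k))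
      \<le> ?r ^ m * (inverse (fact k) * (?r\<^sup>2) ^ k)" by blast
  show "summable (\<lambda>k. ?r ^ m * (inverse (fact k) * (?r\<^sup>2) ^ k))"
    by (rule summable_mult[OF summable_exp])
qed

end

theory Submission
  imports Defs
begin

text \<open>
  The plane spanned by 1 and an imaginary unit \<open>u\<close> is a copy of the complex numbers, on which the
  quaternionic cosine, sine and Bessel functions are the complex ones; this reduces the theorem to complex arguments \<open>z\<close>.
  There, \<open>\<tau> = cos \<theta>\<close> turns the integrals into those of \<open>cos (m \<theta>) cos (z cos \<theta>)\<close> and
  \<open>cos (m \<theta>) sin (z cos \<theta>)\<close> over \<open>[0, \<pi>/2]\<close>. Expanding the outer function into its power series
  leaves the moments of \<open>cos\<^sup>p \<theta>\<close> against \<open>cos (m \<theta>)\<close> with \<open>m \<equiv> p\<close> modulo 2, which are binomial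
  coefficients.
\<close>

section \<open>Trigonometric moments\<close>

text \<open>The base case \<open>p = 0\<close> of the moment induction below.\<close>

lemma integral_cos_even_multiple:
  fixes j :: nat
  shows "((\<lambda>t. cos (2 * real j * t)) has_integral (if j = 0 then pi / 2 else 0)) {0..pi/2}"
proof (cases "j = 0")
  case True
  then show ?thesis
    using has_integral_const_real[of "1::real" 0 "pi/2"] by simp
next
  case False
  have "((\<lambda>t. cos (2 * real j * t)) has_integral
          sin (2 * real j * (pi/2)) / (2 * real j) - sin (2 * real j * 0) / (2 * real j)) {0..pi/2}"
    using False
    by (intro fundamental_theorem_of_calculus)
       (auto intro!: derivative_eq_intros simp flip: has_real_derivative_iff_has_vector_derivative)
  moreover have "sin (real j * pi) = 0" by (simp add: mult.commute)
  ultimately show ?thesis using False by simp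
qed

text \<open>
  The frequency \<open>p - 2 j\<close> may be any integer of the parity of \<open>p\<close> up to \<open>p\<close>; frequencies above \<open>p\<close>
  are covered by \<open>j > p\<close> through the evenness of the cosine.
\<close>

lemma integral_cos_mult_cos_power:
  fixes p j :: nat
  shows "((\<lambda>t. cos ((real p - 2 * real j) * t) * cos t ^ p) has_integral
           pi / 2 * real (p choose j) / 2 ^ p) {0..pi/2}"
proof (induction p arbitrary: j)
  case 0
  show ?case
    using integral_cos_even_multiple[of j] by (cases "j = 0") (simp_all add: binomial_eq_0)
next
  case (Suc p)
  \<comment> \<open>The left neighbour of \<open>p choose j\<close> in Pascal's triangle. At
    \<open>j = 0\<close> it must be 0, whereas truncated subtraction would give
    \<open>p choose 0 = 1\<close>.\<close>
  let ?c = "if j = 0 then 0 else real (p choose (j - 1))"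
  have shifted: "((\<lambda>t. cos ((real p - 2 * real j + 2) * t) * cos t ^ p) has_integral
      pi / 2 * ?c / 2 ^ p) {0..pi/2}"
  proof (cases j)
    case 0
    \<comment> \<open>For \<open>j = 0\<close> the frequency \<open>p + 2\<close> exceeds
      \<open>p\<close>. Up to sign it is the frequency with index \<open>Suc p\<close>, whose
      binomial coefficient is 0.\<close>
    have "cos ((real p - 2 * real (Suc p)) * t) = cos ((real p + 2) * t)" for t
    proof -
      have "(real p - 2 * real (Suc p)) * t = - ((real p + 2) * t)" by (simp add: algebra_simps)
      then show ?thesis by (simp only: cos_minus)
    qed
    then show ?thesis
      using Suc.IH[of "Suc p"] 0 by (simp add: binomial_eq_0)
  next
    case (Suc i)
    then show ?thesis using Suc.IH[of i] by (simp add: algebra_simps)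
  qed
  \<comment> \<open>Product to sum: one factor \<open>cos t\<close> moves the frequency up and down
    by 1, leaving the power \<open>p\<close>.\<close>
  have "cos ((real (Suc p) - 2 * real j) * t) * cos t ^ Suc p =
      1 / 2 * (cos ((real p - 2 * real j + 2) * t) * cos t ^ p
             + cos ((real p - 2 * real j) * t) * cos t ^ p)" for t
  proof -
    define a where "a = (real (Suc p) - 2 * real j) * t"
    have eqs: "(real p - 2 * real j + 2) * t = a + t" "(real p - 2 * real j) * t = a - t"
      by (simp_all add: a_def algebra_simps)
    show ?thesis
      unfolding eqs a_def[symmetric] by (simp add: cos_add cos_diff algebra_simps)
  qed
  then have integrand: "(\<lambda>t. cos ((real (Suc p) - 2 * real j) * t) * cos t ^ Suc p) =
      (\<lambda>t. 1 / 2 * (cos ((real p - 2 * real j + 2) * t) * cos t ^ p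
             + cos ((real p - 2 * real j) * t) * cos t ^ p))" by (rule ext)
  \<comment> \<open>Pascal's rule.\<close>
  have moment: "pi / 2 * real (Suc p choose j) / 2 ^ Suc p =
      1 / 2 * (pi / 2 * ?c / 2 ^ p + pi / 2 * real (p choose j) / 2 ^ p)"
    by (cases j) (simp_all add: field_simps)
  show ?case
    unfolding integrand moment by (intro has_integral_mult_right has_integral_add shifted Suc.IH)
qed

section \<open>The Bessel integrals for complex arguments\<close>

text \<open>The alternating exponential series is the cosine for \<open>e = 0\<close> and the sine for \<open>e = 1\<close>.\<close>

definition trig_term :: "nat \<Rightarrow> nat \<Rightarrow> complex \<Rightarrow> complex" where
  "trig_term e k w = of_real ((-1) ^ k / fact (2 * k + e)) * w ^ (2 * k + e)"

lemma cos_sums: "(\<lambda>k. trig_term 0 k w) sums cos w"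
proof -
  have "(\<lambda>k. cos_coeff (2 * k) *\<^sub>R w ^ (2 * k)) sums cos w"
    by (subst sums_mono_reindex[of "\<lambda>k. 2 * k" "\<lambda>n. cos_coeff n *\<^sub>R w ^ n"])
       (auto simp: strict_mono_def cos_converges, auto simp: cos_coeff_def elim!: evenE split: if_splits)
  then show ?thesis
    by (simp add: trig_term_def cos_coeff_def scaleR_conv_of_real)
qed

lemma sin_sums: "(\<lambda>k. trig_term 1 k w) sums sin w"
proof -
  have "(\<lambda>k. sin_coeff (2 * k + 1) *\<^sub>R w ^ (2 * k + 1)) sums sin w"
    by (subst sums_mono_reindex[of "\<lambda>k. 2 * k + 1" "\<lambda>n. sin_coeff n *\<^sub>R w ^ n"])
       (auto simp: strict_mono_def sin_converges, auto simp: sin_coeff_def elim!: oddE split: if_splits)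
  then show ?thesis
    by (simp add: trig_term_def sin_coeff_def scaleR_conv_of_real)
qed

section \<open>The Bessel series by termwise integration\<close>

definition bessel_term :: "nat \<Rightarrow> complex \<Rightarrow> nat \<Rightarrow> complex" where
  "bessel_term m z k = of_real ((-1) ^ k / (fact k * fact (m + k))) * (z / 2) ^ (m + 2 * k)"

lemma bessel_term_sums: "bessel_term m z sums (\<Sum>k. bessel_term m z k)"
proof (rule summable_sums, rule summable_comparison_test')
  define r where "r = norm (z / 2)"
  show "summable (\<lambda>k. r ^ m * (inverse (fact k) * (r\<^sup>2) ^ k))"
    by (rule summable_mult[OF summable_exp])
  fix k :: nat
  have "norm (bessel_term m z k) = r ^ m * (inverse (fact k) * (r\<^sup>2) ^ k) * inverse (fact (m + k))"
    unfolding bessel_term_def norm_mult norm_power power_add power_mult r_def[symmetric]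
    by (simp add: norm_divide norm_mult norm_power inverse_eq_divide)
  also have "\<dots> \<le> r ^ m * (inverse (fact k) * (r\<^sup>2) ^ k)"
    by (intro mult_right_le_one_le mult_nonneg_nonneg) (auto simp: r_def inverse_le_1_iff fact_ge_1)
  finally show "norm (bessel_term m z k) \<le> r ^ m * (inverse (fact k) * (r\<^sup>2) ^ k)" .
qed

text \<open>The power \<open>2 * k + e\<close> is orthogonal to the frequency
  \<open>2 * n + e\<close> as long as \<open>k < n\<close>. From \<open>k = n\<close> on the moments
  produce the Bessel series, with index shifted by \<open>n\<close>; the shift is the source of the
  sign \<open>(-1) ^ n\<close>.\<close>

lemma integral_cos_mult_trig_term:
  fixes n e k :: nat
  shows "((\<lambda>t. of_real (cos (real (2 * n + e) * t)) * trig_term e k (z * of_real (cos t))) has_integral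
           (if k < n then 0 else of_real (pi / 2 * (-1) ^ n) * bessel_term (2 * n + e) z (k - n))) {0..pi/2}"
proof -
  \<comment> \<open>This \<open>j\<close> makes \<open>p - 2 * j\<close> equal to the negative
    frequency \<open>-(2 * n + e)\<close>. Then \<open>p - j\<close> is \<open>k - n\<close>, so
    \<open>p choose j\<close> vanishes by itself for \<open>k < n\<close>.\<close>
  define p j where "p = 2 * k + e" and "j = k + n + e"
  define C where "C = of_real ((-1) ^ k / fact p) * z ^ p"
  have "((\<lambda>t. of_real (cos ((real p - 2 * real j) * t) * cos t ^ p)) has_integral
          (of_real (pi / 2 * real (p choose j) / 2 ^ p) :: complex)) {0..pi/2}"
    by (rule has_integral_of_real) (rule integral_cos_mult_cos_power)
  from has_integral_mult_right[OF this, of C]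
  have I: "((\<lambda>t. C * of_real (cos ((real p - 2 * real j) * t) * cos t ^ p)) has_integral
          C * of_real (pi / 2 * real (p choose j) / 2 ^ p)) {0..pi/2}" .
  have "cos ((real p - 2 * real j) * t) = cos (real (2 * n + e) * t)" for t
  proof -
    have "(real p - 2 * real j) * t = - (real (2 * n + e) * t)"
      by (simp add: p_def j_def algebra_simps)
    then show ?thesis by (simp only: cos_minus)
  qed
  then have "(\<lambda>t. C * of_real (cos ((real p - 2 * real j) * t) * cos t ^ p)) =
      (\<lambda>t. of_real (cos (real (2 * n + e) * t)) * trig_term e k (z * of_real (cos t)))"
    unfolding C_def trig_term_def p_def[symmetric] power_mult_distrib of_real_mult of_real_power
    by (simp add: mult_ac)
  moreover have "C * of_real (pi / 2 * real (p choose j) / 2 ^ p) =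
      (if k < n then 0 else of_real (pi / 2 * (-1) ^ n) * bessel_term (2 * n + e) z (k - n))"
  proof (cases "k < n")
    case True
    then have "p < j" by (simp add: p_def j_def)
    then show ?thesis using True by simp
  next
    case False
    then obtain l where k: "k = n + l" using le_Suc_ex not_less by blast
    have p: "p = 2 * n + e + 2 * l" "p - j = l" "j \<le> p" "j = 2 * n + e + l"
      by (simp_all add: p_def j_def k)
    \<comment> \<open>Here \<open>fact p\<close> cancels against the factorial in \<open>C\<close>,
      leaving the two factorials of the Bessel coefficient.\<close>
    have "real (p choose j) = fact p / (fact j * fact l)"
      using binomial_fact[OF p(3), where 'a = real] p(2) by simp
    then have coeff: "(-1) ^ k / fact p * (pi / 2 * real (p choose j) / 2 ^ p) =
        pi / 2 * (-1) ^ n * ((-1) ^ l / (fact l * fact j)) / 2 ^ p"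
      by (simp add: k power_add mult_ac)
    have "C * of_real (pi / 2 * real (p choose j) / 2 ^ p) =
        z ^ p * of_real (pi / 2 * (-1) ^ n * ((-1) ^ l / (fact l * fact j)) / 2 ^ p)"
      unfolding C_def coeff[symmetric] of_real_mult by (simp only: mult_ac)
    also have "\<dots> = of_real (pi / 2 * (-1) ^ n) * bessel_term (2 * n + e) z l"
      unfolding bessel_term_def p(1,4)[symmetric] power_divide by (simp add: mult_ac)
    finally show ?thesis by (simp add: k)
  qed
  ultimately show ?thesis using I by simp
qed

text \<open>The series of \<open>g\<close> converges uniformly in the angle, so integration and
  summation may be exchanged.\<close>

lemma bessel_integral_angle:
  fixes n e :: nat and g :: "complex \<Rightarrow> complex"
  assumes g: "\<And>w. (\<lambda>k. trig_term e k w) sums g w"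
    and S: "bessel_term (2 * n + e) z sums s"
  shows "((\<lambda>t. of_real (cos (real (2 * n + e) * t)) * g (z * of_real (cos t))) has_integral
           of_real (pi / 2 * (-1) ^ n) * s) {0..pi/2}"
proof -
  define f where "f k t = of_real (cos (real (2 * n + e) * t)) * trig_term e k (z * of_real (cos t))" for k t
  define F where "F t = of_real (cos (real (2 * n + e) * t)) * g (z * of_real (cos t))" for t
  define c where "c k = (if k < n then 0 else of_real (pi / 2 * (-1) ^ n) * bessel_term (2 * n + e) z (k - n))" for k
  have fc: "(f k has_integral c k) {0..pi/2}" for k
    using integral_cos_mult_trig_term[of n e k z] by (simp add: f_def[abs_def] c_def)
  have f_sums: "(\<lambda>k. f k t) sums F t" for t
    unfolding f_def F_def by (intro sums_mult g)
  have c_sums: "c sums (of_real (pi / 2 * (-1) ^ n) * s)"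
  proof -
    have "(\<lambda>k. c (k + n)) sums (of_real (pi / 2 * (-1) ^ n) * s)"
      using sums_mult[OF S, of "of_real (pi / 2 * (-1) ^ n)"] by (simp add: c_def)
    \<comment> \<open>The first \<open>n\<close> terms of \<open>c\<close> are zero, so the shift
      does not change the sum.\<close>
    then show ?thesis
      by (subst (asm) sums_iff_shift) (simp add: c_def)
  qed
  \<comment> \<open>Since cosines are bounded by 1, a subseries of the exponential series at
    \<open>norm z\<close> dominates.\<close>
  define M where "M k = norm z ^ (2 * k + e) / fact (2 * k + e)" for k
  have M: "norm (f k t) \<le> M k" for k t
  proof -
    have "norm (f k t) = \<bar>cos (real (2 * n + e) * t)\<bar> * (\<bar>cos t\<bar> ^ (2 * k + e) * M k)"
      by (simp add: f_def trig_term_def M_def norm_mult norm_power norm_divide power_mult_distrib)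
    also have "\<dots> \<le> 1 * (1 * M k)"
      by (intro mult_mono power_le_one) (auto simp: M_def)
    finally show ?thesis by simp
  qed
  have "summable M"
  proof -
    have "summable ((\<lambda>k. inverse (fact k) * norm z ^ k) \<circ> (\<lambda>k. 2 * k + e))"
      by (rule summable_reindex) (auto simp: summable_exp inj_def)
    then show ?thesis by (simp add: M_def[abs_def] o_def divide_inverse mult.commute)
  qed
  with M have "uniform_limit {0..pi/2} (\<lambda>N t. \<Sum>k<N. f k t) (\<lambda>t. \<Sum>k. f k t) sequentially"
    by (intro Weierstrass_m_test)
  then have lim: "uniform_limit {0..pi/2} (\<lambda>N t. \<Sum>k<N. f k t) F sequentially"
    by (simp add: sums_unique[OF f_sums, symmetric])
  have cont: "continuous_on {0..pi/2} (\<lambda>t. \<Sum>k<N. f k t)" for N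
    unfolding f_def trig_term_def by (intro continuous_intros)
  obtain I J where I: "\<And>N. ((\<lambda>t. \<Sum>k<N. f k t) has_integral I N) {0..pi/2}"
      and J: "(F has_integral J) {0..pi/2}" and "I \<longlonglongrightarrow> J"
    by (rule uniform_limit_integral[OF lim cont sequentially_bot]) blast
  have "((\<lambda>t. \<Sum>k<N. f k t) has_integral (\<Sum>k<N. c k)) {0..pi/2}" for N
    by (intro has_integral_sum fc) auto
  with I have "I = (\<lambda>N. \<Sum>k<N. c k)"
    using has_integral_unique by blast
  with \<open>I \<longlonglongrightarrow> J\<close> c_sums have "J = of_real (pi / 2 * (-1) ^ n) * s"
    unfolding sums_def by (metis LIMSEQ_unique)
  with J show ?thesis by (simp only: F_def[abs_def])
qed

text \<open>Substituting \<tau> = cos \<theta> absorbs the weight into the derivative of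
  \<open>arccos\<close>.\<close>

lemma bessel_integral_complex:
  fixes n e :: nat and g :: "complex \<Rightarrow> complex"
  assumes g: "\<And>w. (\<lambda>k. trig_term e k w) sums g w"
    and cont: "continuous_on UNIV g"
    and S: "bessel_term (2 * n + e) z sums s"
  shows "((\<lambda>\<tau>. (cos (real (2 * n + e) * arccos \<tau>) / sqrt (1 - \<tau>\<^sup>2)) *\<^sub>R g (z * of_real \<tau>)) has_integral
           of_real (pi / 2 * (-1) ^ n) * s) {0..1}"
proof -
  define F where "F t = of_real (cos (real (2 * n + e) * t)) * g (z * of_real (cos t))" for t
  have "continuous_on {0..pi/2} F"
    unfolding F_def by (intro continuous_intros continuous_on_compose2[OF cont]) auto
  moreover have "arccos ` {0..1} \<subseteq> {0..pi/2}"
    using arccos_lbound arccos_le_pi2 by fastforce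
  \<comment> \<open>The derivative blows up at \<tau> = 1; the substitution rule allows this
    exceptional point.\<close>
  moreover have "(arccos has_field_derivative - inverse (sqrt (1 - \<tau>\<^sup>2))) (at \<tau> within {0..1})"
    if "\<tau> \<in> {0..1} - {1}" for \<tau>
    using that DERIV_arccos[of \<tau>] by (simp add: has_field_derivative_at_within)
  ultimately have "((\<lambda>\<tau>. (- inverse (sqrt (1 - \<tau>\<^sup>2))) *\<^sub>R F (arccos \<tau>)) has_integral
      integral {arccos 0..arccos 1} F - integral {arccos 1..arccos 0} F) {0..1}"
    by (intro has_integral_substitution_general[where s = "{1}"])
       (auto intro: continuous_on_subset[OF continuous_on_arccos'])
  moreover have "(F has_integral of_real (pi / 2 * (-1) ^ n) * s) {0..pi/2}"
    unfolding F_def by (rule bessel_integral_angle[OF g S])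
  \<comment> \<open>As \<open>arccos\<close> decreases, \<open>{arccos 0..arccos 1}\<close> is
    empty, and the integral over \<open>{0..pi/2}\<close> enters with a minus sign.\<close>
  ultimately have "((\<lambda>\<tau>. (- inverse (sqrt (1 - \<tau>\<^sup>2))) *\<^sub>R F (arccos \<tau>)) has_integral
      - (of_real (pi / 2 * (-1) ^ n) * s)) {0..1}"
    by (simp add: integral_unique)
  from has_integral_neg[OF this]
  have "((\<lambda>\<tau>. inverse (sqrt (1 - \<tau>\<^sup>2)) *\<^sub>R F (arccos \<tau>)) has_integral
      of_real (pi / 2 * (-1) ^ n) * s) {0..1}" by simp
  then show ?thesis
    by (rule has_integral_eq[rotated]) (simp add: F_def cos_arccos scaleR_conv_of_real field_simps)
qed

section \<open>Slices of the quaternions\<close>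

lemma quat_half: "(q :: quat) / 2 = (1 / 2) *\<^sub>R q"
proof -
  have "inverse (2 :: quat) = of_real (inverse 2)"
    by (metis of_real_inverse of_real_numeral)
  then have "q / 2 = q * of_real (inverse 2)"
    by (simp only: divide_inverse)
  then show ?thesis by (simp add: of_real_def)
qed

text \<open>Real-linear for every \<open>u\<close>, and an algebra homomorphism from the complex
  numbers once \<open>u * u = -1\<close>.\<close>

definition slice_embed :: "quat \<Rightarrow> complex \<Rightarrow> quat" where
  "slice_embed u z = of_real (Re z) + u * of_real (Im z)"

lemma slice_embed_conv_scaleR: "slice_embed u z = Re z *\<^sub>R 1 + Im z *\<^sub>R u"
  by (simp add: slice_embed_def of_real_def)

lemma bounded_linear_slice_embed: "bounded_linear (slice_embed u)"
  unfolding slice_embed_conv_scaleR[abs_def]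
  by (intro bounded_linear_intros bounded_linear_Re bounded_linear_Im)

lemmas linear_slice_embed = bounded_linear.linear[OF bounded_linear_slice_embed]
lemmas slice_embed_add = linear_add[OF linear_slice_embed]
  and slice_embed_diff = linear_diff[OF linear_slice_embed]
  and slice_embed_minus = linear_neg[OF linear_slice_embed]
  and slice_embed_scaleR = linear_scale[OF linear_slice_embed]

lemma slice_embed_of_real: "slice_embed u (of_real r) = of_real r"
  by (simp add: slice_embed_def)

lemma slice_embed_mult:
  assumes "u * u = -1"
  shows "slice_embed u (z * w) = slice_embed u z * slice_embed u w"
  using assms by (simp add: slice_embed_conv_scaleR algebra_simps)

lemma slice_embed_power:
  assumes "u * u = -1"
  shows "slice_embed u (z ^ n) = slice_embed u z ^ n"
  using slice_embed_of_real[of u 1] by (induction n) (simp_all add: slice_embed_mult[OF assms])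

lemma slice_exp_slice_embed:
  assumes "qRe u = 0" "inner u u = 1"
  shows "slice_exp u (slice_embed u z) = slice_embed u (exp z)"
proof -
  have "slice_exp u (slice_embed u z) =
      of_real (exp (Re z)) * (of_real (cos (Im z)) + u * of_real (sin (Im z)))"
    unfolding slice_embed_def by (rule slice_exp_eq[OF assms])
  also have "\<dots> = slice_embed u (exp z)"
    by (simp add: slice_embed_conv_scaleR Re_exp Im_exp of_real_def algebra_simps)
  finally show ?thesis .
qed

text \<open>The coordinate of a reduced quaternion in its own slice, where it is x0 + I
  \<rho>.\<close>

definition rq_complex :: "quat \<Rightarrow> complex" where
  "rq_complex x = Complex (qRe x) (rq_rho x)"

section \<open>Cosine, sine and Bessel function of a reduced quaternion\<close>

context
  fixes x :: quat
  assumes reduced: "qK x = 0" and rho_pos: "rq_rho x > 0"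
begin

lemma slice_embed_rq_complex: "slice_embed (rq_unit x) (rq_complex x) = x"
  using rq_decomp[OF reduced rho_pos] by (simp add: slice_embed_def rq_complex_def)

lemma rq_unit_mult_eq_slice_embed:
  "rq_unit x * x = slice_embed (rq_unit x) (\<i> * rq_complex x)"
  unfolding rq_unit_mult[OF reduced rho_pos] by (simp add: slice_embed_def rq_complex_def)

lemma slice_exp_rq_unit_mult:
  "slice_exp (rq_unit x) (rq_unit x * x) = slice_embed (rq_unit x) (exp (\<i> * rq_complex x))"
  "slice_exp (rq_unit x) (- (rq_unit x * x)) = slice_embed (rq_unit x) (exp (- (\<i> * rq_complex x)))"
proof -
  have u: "qRe (rq_unit x) = 0" "inner (rq_unit x) (rq_unit x) = 1"
    using rq_unit_inner[OF rho_pos] by (simp_all add: rq_unit_eq)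
  show "slice_exp (rq_unit x) (rq_unit x * x) = slice_embed (rq_unit x) (exp (\<i> * rq_complex x))"
    unfolding rq_unit_mult_eq_slice_embed by (rule slice_exp_slice_embed[OF u])
  have "- (rq_unit x * x) = slice_embed (rq_unit x) (- (\<i> * rq_complex x))"
    unfolding rq_unit_mult_eq_slice_embed
    by (simp add: slice_embed_minus)
  then show "slice_exp (rq_unit x) (- (rq_unit x * x)) = slice_embed (rq_unit x) (exp (- (\<i> * rq_complex x)))"
    by (simp add: slice_exp_slice_embed[OF u])
qed

lemma rq_cos_eq: "rq_cos x = slice_embed (rq_unit x) (cos (rq_complex x))"
proof -
  let ?z = "rq_complex x"
  have "1 / 2 = slice_embed (rq_unit x) (1 / 2)"
    using slice_embed_of_real[of "rq_unit x" "1 / 2"] by simp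
  then have "rq_cos x = slice_embed (rq_unit x) (1 / 2 * (exp (- (\<i> * ?z)) + exp (\<i> * ?z)))"
    unfolding rq_cos_def slice_exp_rq_unit_mult
    by (simp only: slice_embed_mult[OF rq_unit_square[OF rho_pos]] slice_embed_add)
  also have "1 / 2 * (exp (- (\<i> * ?z)) + exp (\<i> * ?z)) = cos ?z"
    by (simp add: cos_exp_eq)
  finally show ?thesis .
qed

lemma rq_sin_eq: "rq_sin x = slice_embed (rq_unit x) (sin (rq_complex x))"
proof -
  let ?z = "rq_complex x"
  have "rq_unit x / 2 = slice_embed (rq_unit x) (\<i> / 2)"
    by (simp add: quat_half slice_embed_conv_scaleR)
  then have "rq_sin x = slice_embed (rq_unit x) (\<i> / 2 * (exp (- (\<i> * ?z)) - exp (\<i> * ?z)))"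
    unfolding rq_sin_def slice_exp_rq_unit_mult
    by (simp only: slice_embed_mult[OF rq_unit_square[OF rho_pos]] slice_embed_diff)
  also have "\<i> / 2 * (exp (- (\<i> * ?z)) - exp (\<i> * ?z)) = sin ?z"
    by (simp add: sin_exp_eq field_simps)
  finally show ?thesis .
qed

text \<open>Multiplicativity of the embedding carries over each term, boundedness the infinite
  sum.\<close>

lemma rq_bessel_eq: "rq_bessel m x = slice_embed (rq_unit x) (\<Sum>k. bessel_term m (rq_complex x) k)"
proof -
  let ?\<phi> = "slice_embed (rq_unit x)" and ?z = "rq_complex x"
  have "?\<phi> (?z / 2) = ?\<phi> ((1 / 2) *\<^sub>R ?z)"
    by (simp add: scaleR_conv_of_real)
  also have "\<dots> = x / 2"
    unfolding slice_embed_scaleR slice_embed_rq_complex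
    by (simp add: quat_half)
  finally have "?\<phi> (bessel_term m ?z k) =
      of_real ((-1) ^ k / (fact k * fact (m + k))) * (x / 2) ^ (m + 2 * k)" for k
    unfolding bessel_term_def
    by (simp only: slice_embed_mult[OF rq_unit_square[OF rho_pos]] slice_embed_of_real
        slice_embed_power[OF rq_unit_square[OF rho_pos]])
  then show ?thesis
    unfolding rq_bessel_def
    using bounded_linear.suminf[OF bounded_linear_slice_embed sums_summable[OF bessel_term_sums],
        of "rq_unit x" m ?z]
    by simp
qed

end

section \<open>Transfer of the integral formulas to reduced quaternions\<close>

lemma scaled_reduced:
  assumes "qK x = 0" "rq_rho x > 0" "\<tau> > 0"
  shows "qK (x * of_real \<tau>) = 0" "rq_rho (x * of_real \<tau>) > 0"
    "rq_unit (x * of_real \<tau>) = rq_unit x" "rq_complex (x * of_real \<tau>) = rq_complex x * of_real \<tau>"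
proof -
  have "x * of_real \<tau> = \<tau> *\<^sub>R x" by (simp add: of_real_def)
  with assms show "qK (x * of_real \<tau>) = 0" "rq_rho (x * of_real \<tau>) > 0"
    "rq_unit (x * of_real \<tau>) = rq_unit x" "rq_complex (x * of_real \<tau>) = rq_complex x * of_real \<tau>"
    by (simp_all add: rq_rho_scale rq_unit_scale rq_complex_def complex_eq_iff)
qed

text \<open>A bounded linear map commutes with integration, so the embedding can be applied to the
  complex formula. Cosine (\<open>e = 0\<close>) and sine (\<open>e = 1\<close>) are both
  instances.\<close>

lemma bessel_integral_reduced:
  fixes n e :: nat
  assumes x: "qK x = 0" "rq_rho x > 0"
    and g: "\<And>w. (\<lambda>k. trig_term e k w) sums g w" "continuous_on UNIV g"
    and h: "\<And>y. qK y = 0 \<Longrightarrow> rq_rho y > 0 \<Longrightarrow> h y = slice_embed (rq_unit y) (g (rq_complex y))"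
  shows "((\<lambda>\<tau>. of_real (cos (real (2 * n + e) * arccos \<tau>) / sqrt (1 - \<tau>\<^sup>2)) * h (x * of_real \<tau>))
           has_integral of_real (pi / 2 * (-1) ^ n) * rq_bessel (2 * n + e) x) {0..1}"
proof -
  let ?\<phi> = "slice_embed (rq_unit x)"
  let ?w = "\<lambda>\<tau>. cos (real (2 * n + e) * arccos \<tau>) / sqrt (1 - \<tau>\<^sup>2)"
  from has_integral_linear[OF bessel_integral_complex[OF g bessel_term_sums]
      bounded_linear_slice_embed, of "rq_unit x" n]
  have "((\<lambda>\<tau>. ?w \<tau> *\<^sub>R ?\<phi> (g (rq_complex x * of_real \<tau>))) has_integral
      of_real (pi / 2 * (-1) ^ n) * rq_bessel (2 * n + e) x) {0..1}"
    unfolding o_def slice_embed_scaleR slice_embed_mult[OF rq_unit_square[OF x(2)]]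
      slice_embed_of_real rq_bessel_eq[OF x] .
  \<comment> \<open>Positive scaling keeps the imaginary unit, so the one embedding for
    \<open>x\<close> serves every \<tau> > 0.\<close>
  moreover have "of_real (?w \<tau>) * h (x * of_real \<tau>) = ?w \<tau> *\<^sub>R ?\<phi> (g (rq_complex x * of_real \<tau>))"
    if "\<tau> \<in> {0..1} - {0}" for \<tau>
    using that scaled_reduced[OF x, of \<tau>] by (simp add: h scaleR_conv_of_real)
  ultimately show ?thesis
    \<comment> \<open>At \<open>\<tau> = 0\<close> the imaginary unit of \<open>x \<tau>\<close> is the junk value 0.\<close>
    by (rule has_integral_spike_finite[OF finite.insertI[OF finite.emptyI], rotated])
qed

theorem mainTheorem11:
  fixes n :: nat and x0 x1 x2 :: real and x :: quat
  assumes "x = rq x0 x1 x2"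
    and "sqrt (x1\<^sup>2 + x2\<^sup>2) > 0"
  shows "((\<lambda>\<tau>. of_real (cos (2 * real n * arccos \<tau>) / sqrt (1 - \<tau>\<^sup>2)) * rq_cos (x * of_real \<tau>))
           has_integral of_real (pi / 2 * (-1) ^ n) * rq_bessel (2 * n) x) {0..1}
       \<and> ((\<lambda>\<tau>. of_real (cos ((2 * real n + 1) * arccos \<tau>) / sqrt (1 - \<tau>\<^sup>2)) * rq_sin (x * of_real \<tau>))
           has_integral of_real (pi / 2 * (-1) ^ n) * rq_bessel (2 * n + 1) x) {0..1}"
proof -
  have x: "qK x = 0" "rq_rho x > 0"
    using assms by (simp_all add: rq_sel rq_rho_def)
  have "continuous_on UNIV (cos :: complex \<Rightarrow> complex)" "continuous_on UNIV (sin :: complex \<Rightarrow> complex)"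
    by (intro continuous_intros)+
  then show ?thesis
    using bessel_integral_reduced[OF x cos_sums _ rq_cos_eq, of n]
      bessel_integral_reduced[OF x sin_sums _ rq_sin_eq, of n]
    by (simp add: add.commute)
qed

end
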